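(* Let $(\widetilde{X},|\cdot|)$ be a uniformly convex normed space, and let $X\subseteq \widetilde{X}$ be closed, convex, nonempty and not a singleton. Let $K$ be a (possibly infinite) index set with at least two elements, and let $(P_k)_{k\in K}$, $(P'_k)_{k\in K}$ be two given tuples of nonempty subsets of $X$ with the property that the distance between each $x\in X$ and each $P_k$, $P'_k$ is attained. Suppose that $$\eta:=\inf\{d(P_k,P_j): j,k\in K,\ j\neq k\}>0,$$ and let $A_k=\bigcup_{j\neq k}P_j$, $A'_k=\bigcup_{j\neq k}P'_j$ for each $k\in K$. Suppose also that there exists $\rho\in(0,\infty)$ such that for all $k\in K$ and for all $x\in X$ the open ball $B(x,\rho)$ intersects $A_k$. For each $k\in K$ let $R_k=\operatorname{dom}(P_k,A_k)$ and $R'_k=\operatorname{dom}(P'_k,A'_k)$ be, respectively, the Voronoi cells associated with the original site $P_k$ and the perturbed one $P'_k$. Then for each $\epsilon\in(0,\eta/6)$ there exists $\Delta>0$, namely $\Delta=\min\{C\epsilon^2,\,0.5\,\epsilon\}$ for any positive $C$ satisfying $$C\leq \frac{1}{16(\rho+5\eta/12)}\cdot\delta\left(\frac{\eta}{12\rho+5\eta}\right),$$ such that if the inequality $D(P_k,P'_k)<\Delta$ holds for each $k\in K$, then $D(R_k,R'_k)<\epsilon$ for each $k\in K$.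
   Context: Normed spaces may be real or complex, finite or infinite dimensional, not necessarily complete. $d(x,y)=|x-y|$; for nonempty sets, $d(x,A)=\inf\{d(x,a):a\in A\}$ and $d(A_1,A_2)=\inf\{d(a_1,a_2):a_1\in A_1,a_2\in A_2\}$. "The distance between $x$ and $P$ is attained" means that there is $p\in P$ with $d(x,p)=d(x,P)$. $B(x,r)$ is the open ball of center $x$ and radius $r>0$. For nonempty $P,A\subseteq X$, $\operatorname{dom}(P,A)=\{x\in X: d(x,P)\leq d(x,A)\}$. The Hausdorff distance between nonempty sets is $D(A_1,A_2)=\max\{\sup_{a_1\in A_1}d(a_1,A_2),\ \sup_{a_2\in A_2}d(a_2,A_1)\}\in[0,\infty]$. $(\widetilde X,|\cdot|)$ is uniformly convex if for any $\epsilon\in(0,2]$ there is $\delta\in(0,1]$ such that $|x|=|y|=1$ and $|x-y|\ge\epsilon$ imply $|(x+y)/2|\le 1-\delta$. Throughout, $\delta:[0,2]\to[0,1]$ is a fixed increasing (i.e. non-decreasing) function assigning such a value to each $\epsilon$: $\delta(0)=0$, $\delta(\epsilon)>0$ for $\epsilon\in(0,2]$, and $|x|=|y|=1$, $|x-y|\geq\epsilon$ imply $|(x+y)/2|\leq 1-\delta(\epsilon)$. One possible choice is the modulus of convexity $\delta(\epsilon)=\inf\{1-|(x+y)/2|: |x-y|\geq\epsilon,\ |x|=|y|=1\}$. *)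

theory Defs
  imports "HOL-Analysis.Analysis"
begin

definition uniformly_convex :: "'a::real_normed_vector itself \<Rightarrow> bool" where
  "uniformly_convex _ \<longleftrightarrow>
     (\<forall>\<epsilon>. 0 < \<epsilon> \<and> \<epsilon> \<le> 2 \<longrightarrow>
       (\<exists>d. 0 < d \<and> d \<le> 1 \<and>
         (\<forall>x y :: 'a. norm x = 1 \<and> norm y = 1 \<and> norm (x - y) \<ge> \<epsilon> \<longrightarrow>
            norm ((x + y) /\<^sub>R 2) \<le> 1 - d)))"

text \<open>A non-decreasing choice \<open>\<delta> : [0,2] \<rightarrow> [0,1]\<close> of witnesses for uniform convexity, not
  necessarily the modulus of convexity; the values of \<open>\<delta>\<close> outside \<open>[0,2]\<close> are irrelevant.\<close>

definition convexity_witness :: "'a::real_normed_vector itself \<Rightarrow> (real \<Rightarrow> real) \<Rightarrow> bool" where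
  "convexity_witness _ \<delta> \<longleftrightarrow>
     \<delta> \<in> {0..2} \<rightarrow> {0..1} \<and> mono_on {0..2} \<delta> \<and> \<delta> 0 = 0 \<and>
     (\<forall>\<epsilon>. 0 < \<epsilon> \<and> \<epsilon> \<le> 2 \<longrightarrow>
       \<delta> \<epsilon> > 0 \<and>
       (\<forall>x y :: 'a. norm x = 1 \<and> norm y = 1 \<and> norm (x - y) \<ge> \<epsilon> \<longrightarrow>
          norm ((x + y) /\<^sub>R 2) \<le> 1 - \<delta> \<epsilon>))"

definition distance_attained :: "'a::metric_space \<Rightarrow> 'a set \<Rightarrow> bool" where
  "distance_attained x P \<longleftrightarrow> (\<exists>p\<in>P. dist x p = infdist x P)"

text \<open>Meant for nonempty \<open>P\<close> and \<open>A\<close>; recall that \<^term>\<open>infdist x {} = 0\<close>. The same applies to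
  the Hausdorff distance below.\<close>

definition dominance_region :: "'a::metric_space set \<Rightarrow> 'a set \<Rightarrow> 'a set \<Rightarrow> 'a set" where
  "dominance_region X P A = {x \<in> X. infdist x P \<le> infdist x A}"

definition hausdorff_distance :: "'a::metric_space set \<Rightarrow> 'a set \<Rightarrow> ereal" where
  "hausdorff_distance A B =
     max (SUP a\<in>A. ereal (infdist a B)) (SUP b\<in>B. ereal (infdist b A))"

definition other_sites :: "'i set \<Rightarrow> ('i \<Rightarrow> 'a set) \<Rightarrow> 'i \<Rightarrow> 'a set" where
  "other_sites K P k = (\<Union>j\<in>K - {k}. P j)"

definition voronoi_cell :: "'a::metric_space set \<Rightarrow> 'i set \<Rightarrow> ('i \<Rightarrow> 'a set) \<Rightarrow> 'i \<Rightarrow> 'a set" where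
  "voronoi_cell X K P k = dominance_region X (P k) (other_sites K P k)"

definition site_separation :: "'i set \<Rightarrow> ('i \<Rightarrow> 'a::metric_space set) \<Rightarrow> real" where
  "site_separation K P = Inf {setdist (P k) (P j) | j k. j \<in> K \<and> k \<in> K \<and> j \<noteq> k}"

end

theory Submission
  imports Defs
begin

text \<open>Given \<open>x\<close> in a cell, let \<open>p\<close> be a nearest point of the site and move from \<open>x\<close> towards \<open>p\<close> by
  \<open>\<epsilon> / 2\<close> to reach \<open>y\<close> (if \<open>x\<close> is already close to \<open>p\<close>, take \<open>y = x\<close>). For a point \<open>a\<close> of another site the
  directions of \<open>x - y\<close> and \<open>y - a\<close> differ by a fixed amount because \<open>a\<close> and \<open>p\<close> are far apart, so
  uniform convexity makes the triangle inequality \<open>|x - a| \<le> |x - y| + |y - a|\<close> strict by a definite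
  amount. Hence \<open>y\<close> is closer to \<open>p\<close> than to \<open>a\<close> by a margin that survives the perturbation. The
  argument applies to both inclusions; moving by \<open>\<epsilon> / 2\<close> rather than \<open>\<epsilon>\<close> keeps the suprema in the
  Hausdorff distance strictly below \<open>\<epsilon>\<close>.\<close>

text \<open>Cut from \<open>v\<close> a piece as long as the shorter vector \<open>u\<close>. On the
  two pieces of equal length the convexity bound for the unit vectors \<open>sgn u\<close> and
  \<open>sgn v\<close> saves \<open>2 * norm u * d\<close>; the rest of \<open>v\<close> costs only
  its own length.\<close>

lemma norm_add_le_of_convexity:
  fixes u v :: "'a::real_normed_vector"
  assumes d: "\<And>x y :: 'a. norm x = 1 \<Longrightarrow> norm y = 1 \<Longrightarrow> norm (x - y) \<ge> e \<Longrightarrow>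
      norm ((x + y) /\<^sub>R 2) \<le> 1 - d"
    and u: "u \<noteq> 0" and uv: "norm u \<le> norm v"
    and e: "norm (sgn u - sgn v) \<ge> e"
  shows "norm (u + v) \<le> norm u + norm v - 2 * norm u * d"
proof -
  have v: "v \<noteq> 0" using u uv by auto
  have "norm (sgn u + sgn v) / 2 = norm ((sgn u + sgn v) /\<^sub>R 2)" by simp
  also have "\<dots> \<le> 1 - d" using u v e by (intro d) (auto simp: norm_sgn)
  finally have le: "norm (sgn u + sgn v) \<le> 2 * (1 - d)" by simp
  have su: "u = norm u *\<^sub>R sgn u" and sv: "v = norm v *\<^sub>R sgn v"
    using u v by (simp_all add: sgn_div_norm)
  have "u + v = norm u *\<^sub>R (sgn u + sgn v) + (norm v - norm u) *\<^sub>R sgn v"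
    by (subst su, subst sv) (simp add: algebra_simps sgn_div_norm)
  then have "norm (u + v) \<le> norm u * norm (sgn u + sgn v) + (norm v - norm u) * norm (sgn v)"
    using norm_triangle_ineq[of "norm u *\<^sub>R (sgn u + sgn v)" "(norm v - norm u) *\<^sub>R sgn v"] uv by simp
  also have "\<dots> \<le> norm u * (2 * (1 - d)) + (norm v - norm u)"
    using mult_left_mono[OF le norm_ge_zero[of u]] v by (simp add: norm_sgn)
  finally show ?thesis by (simp add: algebra_simps)
qed

lemma infdist_le_add:
  assumes "A \<noteq> {}" and "\<And>a. a \<in> A \<Longrightarrow> \<exists>b\<in>B. dist a b < D"
  shows "infdist x B \<le> infdist x A + D"
proof -
  have "infdist x B - D \<le> dist x a" if a: "a \<in> A" for a
  proof -
    obtain b where "b \<in> B" "dist a b < D" using assms(2) a by blast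
    then show ?thesis using infdist_le[of b B x] dist_triangle[of x b a] by linarith
  qed
  then have "infdist x B - D \<le> infdist x A"
    using assms(1) by (auto simp: infdist_notempty intro!: cINF_greatest)
  then show ?thesis by simp
qed

lemma hausdorff_distance_commute: "hausdorff_distance A B = hausdorff_distance B A"
  by (simp add: hausdorff_distance_def max.commute)

text \<open>An infimum strictly below \<open>D\<close> has a member below \<open>D\<close>. With
  \<open>B\<close> empty this breaks down: \<open>infdist a {}\<close> is 0, so the bound could hold
  with no point to offer.\<close>

lemma hausdorff_distance_lessD:
  assumes "hausdorff_distance A B < ereal D" "a \<in> A" "B \<noteq> {}"
  shows "\<exists>b\<in>B. dist a b < D"
proof -
  have "ereal (infdist a B) \<le> (SUP a\<in>A. ereal (infdist a B))" using assms(2) by (rule SUP_upper)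
  also have "\<dots> < ereal D" using assms(1) by (simp add: hausdorff_distance_def)
  finally have "(INF b\<in>B. dist a b) < D" using assms(3) by (simp add: infdist_notempty)
  then show ?thesis using assms(3) by (subst (asm) cINF_less_iff) auto
qed

lemma hausdorff_distance_le:
  assumes "\<And>a. a \<in> A \<Longrightarrow> \<exists>b\<in>B. dist a b \<le> D" "\<And>b. b \<in> B \<Longrightarrow> \<exists>a\<in>A. dist b a \<le> D"
  shows "hausdorff_distance A B \<le> ereal D"
  unfolding hausdorff_distance_def
  using assms by (intro max.boundedI SUP_least) (auto, meson infdist_le2, meson infdist_le2)

lemma site_separation_le:
  assumes "j \<in> K" "k \<in> K" "j \<noteq> k" "p \<in> P k" "a \<in> P j"
  shows "site_separation K P \<le> dist p a"
proof -
  have "site_separation K P \<le> setdist (P k) (P j)"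
    unfolding site_separation_def
    by (rule cInf_lower) (use assms in \<open>auto intro!: bdd_belowI[of _ 0] setdist_pos_le\<close>)
  also have "\<dots> \<le> dist p a" using assms by (intro setdist_le_dist)
  finally show ?thesis .
qed

text \<open>The separation \<open>\<eta> - \<epsilon>\<close> and the radius
  \<open>\<rho> + \<epsilon> / 2\<close> are weak enough to hold for the perturbed sites too, so the
  same statement serves with the two families exchanged.\<close>

lemma dominance_region_perturb:
  fixes X P A :: "'a::real_normed_vector set"
  assumes d: "\<And>x y :: 'a. norm x = 1 \<Longrightarrow> norm y = 1 \<Longrightarrow> norm (x - y) \<ge> \<eta> / (12 * \<rho> + 5 * \<eta>) \<Longrightarrow>
      norm ((x + y) /\<^sub>R 2) \<le> 1 - d"
    and X: "convex X" "P \<subseteq> X"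
    and x: "x \<in> dominance_region X P A" "distance_attained x P" "infdist x A \<le> \<rho> + \<epsilon> / 2"
    and ne: "A \<noteq> {}" "A' \<noteq> {}"
    and sep: "\<And>p a. p \<in> P \<Longrightarrow> a \<in> A \<Longrightarrow> \<eta> - \<epsilon> \<le> dist p a"
    and PP': "\<And>p. p \<in> P \<Longrightarrow> \<exists>p'\<in>P'. dist p p' < \<Delta>"
    and A'A: "\<And>a'. a' \<in> A' \<Longrightarrow> \<exists>a\<in>A. dist a' a < \<Delta>"
    and eps: "0 < \<epsilon>" "6 * \<epsilon> < \<eta>" and rho: "0 < \<rho>"
    and Delta: "2 * \<Delta> \<le> \<epsilon>" "2 * \<Delta> \<le> \<epsilon> * d"
  shows "\<exists>y\<in>dominance_region X P' A'. dist x y \<le> \<epsilon> / 2"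
proof -
  obtain p where p: "p \<in> P" "dist x p = infdist x P"
    using x(2) unfolding distance_attained_def by blast
  define r where "r = dist x p"
  have xX: "x \<in> X" and r_le: "r \<le> infdist x A"
    using x(1) p by (auto simp: dominance_region_def r_def)
  have r_le_dist: "r \<le> dist x a" if "a \<in> A" for a
    using r_le infdist_le[OF that, of x] by linarith
  \<comment> \<open>One \<open>\<Delta>\<close> of the margin pays for replacing \<open>p\<close> by
    a point of \<open>P'\<close>, the other for replacing \<open>A\<close> by
    \<open>A'\<close>.\<close>
  have key: "y \<in> dominance_region X P' A'"
    if yX: "y \<in> X" and ya: "\<And>a. a \<in> A \<Longrightarrow> dist y p + 2 * \<Delta> \<le> dist y a" for y
  proof -
    obtain p' where p': "p' \<in> P'" "dist p p' < \<Delta>" using PP' p by blast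
    have "infdist y P' \<le> dist y p + \<Delta>"
      using infdist_le[OF p'(1), of y] dist_triangle[of y p' p] p'(2) by linarith
    moreover have "dist y p + 2 * \<Delta> \<le> infdist y A"
      using ya ne by (auto simp: infdist_notempty intro!: cINF_greatest)
    moreover have "infdist y A \<le> infdist y A' + \<Delta>"
      using ne A'A by (intro infdist_le_add) auto
    ultimately show ?thesis using yX by (simp add: dominance_region_def)
  qed
  show ?thesis
  proof (cases "r \<le> \<epsilon>")
    case True
    have "dist x p + 2 * \<Delta> \<le> dist x a" if "a \<in> A" for a
      using sep[OF p(1) that] dist_triangle2[of p a x] dist_commute[of a x] dist_commute[of p x]
        dist_triangle[of p a x] True eps Delta r_def
      by linarith
    then show ?thesis using key[OF xX] eps by (intro bexI[of _ x]) auto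
  next
    case False
    define t where "t = \<epsilon> / 2 / r"
    define y where "y = (1 - t) *\<^sub>R x + t *\<^sub>R p"
    have r: "r > \<epsilon>" "r > 0" using False eps by auto
    have t: "0 < t" "t < 1" "t * r = \<epsilon> / 2" using r eps by (auto simp: t_def field_simps)
    have yX: "y \<in> X"
      unfolding y_def using X p xX t by (intro convexD) auto
    have xy: "x - y = t *\<^sub>R (x - p)" and yp: "y - p = (1 - t) *\<^sub>R (x - p)"
      by (simp_all add: y_def algebra_simps)
    have nxp: "norm (x - p) = r" by (simp add: r_def dist_norm)
    have nxy: "norm (x - y) = \<epsilon> / 2" using xy t nxp by simp
    have nyp: "norm (y - p) = r - \<epsilon> / 2" unfolding yp using t nxp by (simp add: left_diff_distrib)
    have ya: "dist y p + 2 * \<Delta> \<le> dist y a" if a: "a \<in> A" for a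
    proof (rule ccontr)
      assume "\<not> ?thesis"
      then have lt: "norm (y - a) < r - \<epsilon> / 2 + 2 * \<Delta>" using nyp by (simp add: dist_norm)
      have xa: "r \<le> norm (x - a)" using r_le_dist[OF a] by (simp add: dist_norm)
      \<comment> \<open>Together with \<open>lt\<close> this puts \<open>norm (y - a)\<close>
        between \<open>norm (y - p)\<close> and \<open>norm (y - p) + \<epsilon>\<close>.\<close>
      have ge: "r - \<epsilon> / 2 \<le> norm (y - a)"
        using xa nxy norm_triangle_ineq[of "x - y" "y - a"] by simp
      have le: "norm (y - a) \<le> \<rho> + \<epsilon>" using lt r_le x(3) Delta by linarith
      have pos: "norm (y - a) > 0" using ge r eps by linarith
      have sx: "sgn (x - y) = sgn (y - p)"
        using t by (simp add: xy yp sgn_scaleR)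
      have dec: "y - a = norm (y - a) *\<^sub>R sgn (y - a)" "y - p = norm (y - p) *\<^sub>R sgn (y - p)"
        using pos nyp r eps by (auto simp: sgn_div_norm)
      \<comment> \<open>Separates the difference of directions from the difference of lengths. The
        latter is at most \<epsilon>, so the distance between \<open>p\<close> and \<open>a\<close>
        must come mostly from the directions.\<close>
      have "p - a = norm (y - a) *\<^sub>R (sgn (y - a) - sgn (y - p))
          + (norm (y - a) - norm (y - p)) *\<^sub>R sgn (y - p)"
        using dec by (simp add: scaleR_right_diff_distrib scaleR_left_diff_distrib)
      then have "norm (p - a) \<le> norm (y - a) * norm (sgn (y - a) - sgn (y - p))
          + \<bar>norm (y - a) - norm (y - p)\<bar> * norm (sgn (y - p))"
        by (metis norm_triangle_ineq norm_scaleR abs_norm_cancel)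
      also have "\<dots> \<le> norm (y - a) * norm (sgn (y - a) - sgn (y - p)) + \<epsilon>"
        using lt ge nyp Delta r eps by (auto simp: norm_sgn)
      finally have "\<eta> - 2 * \<epsilon> \<le> norm (y - a) * norm (sgn (y - a) - sgn (y - p))"
        using sep[OF p(1) a] by (simp add: dist_norm)
      also have "\<dots> \<le> (\<rho> + \<epsilon>) * norm (sgn (y - a) - sgn (y - p))"
        using le by (intro mult_right_mono) auto
      finally have "(\<eta> - 2 * \<epsilon>) / (\<rho> + \<epsilon>) \<le> norm (sgn (y - a) - sgn (y - p))"
        using rho eps by (simp add: field_simps)
      \<comment> \<open>Since \<epsilon> is below \<open>\<eta> / 6\<close>, the numerator is at
        least \<open>\<eta> / 2\<close> and twice the denominator is at most
        \<open>12 * \<rho> + 5 * \<eta>\<close>.\<close>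
      moreover have "\<eta> / (12 * \<rho> + 5 * \<eta>) \<le> (\<eta> - 2 * \<epsilon>) / (\<rho> + \<epsilon>)"
      proof -
        have "\<eta> / (12 * \<rho> + 5 * \<eta>) \<le> (\<eta> / 2) / (\<rho> + \<epsilon>)"
        proof -
          have "(\<rho> + \<epsilon>) * \<eta> \<le> (6 * \<rho> + 5 * \<eta> / 2) * \<eta>"
            using eps rho by (intro mult_right_mono) auto
          then show ?thesis using eps rho by (simp add: field_simps)
        qed
        also have "\<dots> \<le> (\<eta> - 2 * \<epsilon>) / (\<rho> + \<epsilon>)"
          using eps rho by (intro divide_right_mono) auto
        finally show ?thesis .
      qed
      ultimately have "\<eta> / (12 * \<rho> + 5 * \<eta>) \<le> norm (sgn (x - y) - sgn (y - a))"
        by (simp add: sx norm_minus_commute)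
      \<comment> \<open>Here \<open>x - y\<close> is the shorter vector because
        \<open>r > \<epsilon>\<close>. Its length \<open>\<epsilon> / 2\<close> makes the saving
        \<open>\<epsilon> * d\<close>, which is at least \<open>2 * \<Delta>\<close> and so
        contradicts \<open>lt\<close>.\<close>
      then have "norm ((x - y) + (y - a)) \<le>
          norm (x - y) + norm (y - a) - 2 * norm (x - y) * d"
        using nxy eps ge r by (intro norm_add_le_of_convexity[OF d]) auto
      then have "r \<le> \<epsilon> / 2 + norm (y - a) - \<epsilon> * d" using xa nxy by simp
      then show False using lt Delta by linarith
    qed
    show ?thesis using key[OF yX ya] nxy by (auto simp: dist_norm intro!: bexI[of _ y])
  qed
qed

theorem theorem8p10:
  fixes X :: "'a::real_normed_vector set"
    and K :: "'i set"
    and P P' :: "'i \<Rightarrow> 'a set"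
    and \<delta> :: "real \<Rightarrow> real"
    and \<eta> \<rho> :: real
  assumes uc: "uniformly_convex TYPE('a)"
    and delta: "convexity_witness TYPE('a) \<delta>"
    and X: "closed X" "convex X" "X \<noteq> {}" "\<nexists>x. X = {x}"
    and K: "\<exists>j\<in>K. \<exists>k\<in>K. j \<noteq> k"
    and P: "\<And>k. k \<in> K \<Longrightarrow> P k \<noteq> {} \<and> P k \<subseteq> X"
    and P': "\<And>k. k \<in> K \<Longrightarrow> P' k \<noteq> {} \<and> P' k \<subseteq> X"
    and P_attained: "\<And>k x. k \<in> K \<Longrightarrow> x \<in> X \<Longrightarrow> distance_attained x (P k)"
    and P'_attained: "\<And>k x. k \<in> K \<Longrightarrow> x \<in> X \<Longrightarrow> distance_attained x (P' k)"
    and eta_def: "\<eta> = site_separation K P"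
    and eta_pos: "\<eta> > 0"
    and rho_pos: "\<rho> > 0"
    and rho: "\<And>k x. k \<in> K \<Longrightarrow> x \<in> X \<Longrightarrow> ball x \<rho> \<inter> other_sites K P k \<noteq> {}"
  shows "(\<exists>C>0. C \<le> 1 / (16 * (\<rho> + 5 * \<eta> / 12)) * \<delta> (\<eta> / (12 * \<rho> + 5 * \<eta>))) \<and>
    (\<forall>\<epsilon>. 0 < \<epsilon> \<and> \<epsilon> < \<eta> / 6 \<longrightarrow>
      (\<forall>C>0. C \<le> 1 / (16 * (\<rho> + 5 * \<eta> / 12)) * \<delta> (\<eta> / (12 * \<rho> + 5 * \<eta>)) \<longrightarrow>
        (\<exists>\<Delta>>0. \<Delta> = min (C * \<epsilon>\<^sup>2) (0.5 * \<epsilon>) \<and>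
          ((\<forall>k\<in>K. hausdorff_distance (P k) (P' k) < ereal \<Delta>) \<longrightarrow>
           (\<forall>k\<in>K. hausdorff_distance (voronoi_cell X K P k) (voronoi_cell X K P' k)
                     < ereal \<epsilon>)))))"
proof -
  define d where "d = \<delta> (\<eta> / (12 * \<rho> + 5 * \<eta>))"
  \<comment> \<open>Only on this range does \<delta> have to be positive and to bound
    midpoints.\<close>
  have e: "0 < \<eta> / (12 * \<rho> + 5 * \<eta>)" "\<eta> / (12 * \<rho> + 5 * \<eta>) \<le> 2"
    using eta_pos rho_pos by (auto simp: field_simps)
  then have d_pos: "0 < d" and d: "\<And>x y :: 'a. norm x = 1 \<Longrightarrow> norm y = 1 \<Longrightarrow>
      norm (x - y) \<ge> \<eta> / (12 * \<rho> + 5 * \<eta>) \<Longrightarrow> norm ((x + y) /\<^sub>R 2) \<le> 1 - d"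
    using delta unfolding convexity_witness_def d_def by blast+
  define C0 where "C0 = 1 / (16 * (\<rho> + 5 * \<eta> / 12)) * d"
  have C0: "0 < C0" using d_pos eta_pos rho_pos by (simp add: C0_def)
  have main: "hausdorff_distance (voronoi_cell X K P k) (voronoi_cell X K P' k) < ereal \<epsilon>"
    if eps: "0 < \<epsilon>" "\<epsilon> < \<eta> / 6" and C: "0 < C" "C \<le> C0"
      and Delta: "\<Delta> = min (C * \<epsilon>\<^sup>2) (0.5 * \<epsilon>)"
      and H: "\<forall>k\<in>K. hausdorff_distance (P k) (P' k) < ereal \<Delta>" and k: "k \<in> K" for \<epsilon> C \<Delta> k
  proof -
    have D1: "2 * \<Delta> \<le> \<epsilon>" by (simp add: Delta)
    have "\<Delta> \<le> C0 * \<epsilon>\<^sup>2"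
      using mult_right_mono[OF C(2), of "\<epsilon>\<^sup>2"] by (simp add: Delta min_le_iff_disj)
    also have "\<dots> = (\<epsilon> / (16 * (\<rho> + 5 * \<eta> / 12))) * (\<epsilon> * d)"
      by (simp add: C0_def power2_eq_square)
    \<comment> \<open>One factor \<epsilon> of the quadratic bound is kept as the step length; the
      other is absorbed, as \<epsilon> is below
      \<open>8 * (\<rho> + 5 * \<eta> / 12)\<close>.\<close>
    also have "\<dots> \<le> (1 / 2) * (\<epsilon> * d)"
      using eps rho_pos eta_pos d_pos by (intro mult_right_mono) (auto simp: field_simps)
    finally have D2: "2 * \<Delta> \<le> \<epsilon> * d" by simp
    have PP': "\<exists>p'\<in>P' j. dist p p' < \<Delta>" if "j \<in> K" "p \<in> P j" for j p
      using that H P' by (intro hausdorff_distance_lessD[of "P j"]) auto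
    have P'P: "\<exists>p\<in>P j. dist p' p < \<Delta>" if "j \<in> K" "p' \<in> P' j" for j p'
      using that H P by (intro hausdorff_distance_lessD[of "P' j"])
        (auto simp: hausdorff_distance_commute[of "P' j"])
    let ?A = "other_sites K P k" and ?A' = "other_sites K P' k"
    obtain j where "j \<in> K" "j \<noteq> k" using K by blast
    then have ne: "?A \<noteq> {}" "?A' \<noteq> {}" using P P' by (fastforce simp: other_sites_def)+
    have AA': "\<exists>a'\<in>?A'. dist a a' < \<Delta>" if "a \<in> ?A" for a
      using that PP' unfolding other_sites_def by blast
    have A'A: "\<exists>a\<in>?A. dist a' a < \<Delta>" if "a' \<in> ?A'" for a'
      using that P'P unfolding other_sites_def by blast
    have sep: "\<eta> \<le> dist p a" if "p \<in> P k" "a \<in> ?A" for p a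
      using that k unfolding eta_def other_sites_def by (auto intro: site_separation_le)
    \<comment> \<open>Both points lie within \<Delta> of original sites, so at most
      \<open>2 * \<Delta>\<close> of the separation is lost.\<close>
    have sep': "\<eta> - \<epsilon> \<le> dist p' a'" if p': "p' \<in> P' k" and a': "a' \<in> ?A'" for p' a'
    proof -
      obtain p a where "p \<in> P k" "dist p' p < \<Delta>" "a \<in> ?A" "dist a' a < \<Delta>"
        using P'P[OF k p'] A'A[OF a'] by blast
      then show ?thesis
        using sep[of p a] dist_triangle[of p a p'] dist_triangle[of p' a a'] D1
          dist_commute[of p p'] by linarith
    qed
    have inf: "infdist x ?A \<le> \<rho>" if x: "x \<in> X" for x
    proof -
      obtain a where "a \<in> ?A" "dist x a < \<rho>" using rho[OF k x] by auto
      then show ?thesis by (intro infdist_le2) auto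
    qed
    have inf': "infdist x ?A' \<le> \<rho> + \<epsilon> / 2" if "x \<in> X" for x
      using inf[OF that] infdist_le_add[OF ne(1) AA', of x] D1 by simp
    note perturb = dominance_region_perturb[where \<eta> = \<eta> and \<rho> = \<rho> and d = d
        and \<epsilon> = \<epsilon> and \<Delta> = \<Delta>, OF _ X(2)]
    have "\<exists>y\<in>voronoi_cell X K P' k. dist x y \<le> \<epsilon> / 2" if x: "x \<in> voronoi_cell X K P k" for x
    proof -
      have xX: "x \<in> X" using x by (simp add: voronoi_cell_def dominance_region_def)
      show ?thesis
        unfolding voronoi_cell_def
      proof (rule perturb[where P = "P k" and A = ?A], erule (2) d)
        show "infdist x ?A \<le> \<rho> + \<epsilon> / 2" using inf[OF xX] eps by simp
        show "\<eta> - \<epsilon> \<le> dist p a" if "p \<in> P k" "a \<in> ?A" for p a using sep[OF that] eps by simp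
      qed (use x xX eps rho_pos D1 D2 k P P_attained PP' A'A ne in \<open>auto simp: voronoi_cell_def\<close>)
    qed
    \<comment> \<open>The exchanged roles: here the weakened bounds \<open>sep'\<close> and
      \<open>inf'\<close> are what is available.\<close>
    moreover have "\<exists>y\<in>voronoi_cell X K P k. dist x y \<le> \<epsilon> / 2"
      if x: "x \<in> voronoi_cell X K P' k" for x
    proof -
      have xX: "x \<in> X" using x by (simp add: voronoi_cell_def dominance_region_def)
      show ?thesis
        unfolding voronoi_cell_def
        by (rule perturb[where P = "P' k" and A = ?A'], erule (2) d)
          (use x xX eps rho_pos D1 D2 k P' P'_attained P'P AA' ne sep' inf' in
            \<open>auto simp: voronoi_cell_def\<close>)
    qed
    ultimately have "hausdorff_distance (voronoi_cell X K P k) (voronoi_cell X K P' k) \<le> ereal (\<epsilon> / 2)"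
      by (intro hausdorff_distance_le)
    also have "\<dots> < ereal \<epsilon>" using eps by simp
    finally show ?thesis .
  qed
  show ?thesis
    unfolding d_def[symmetric] C0_def[symmetric]
  proof (intro conjI allI impI)
    \<comment> \<open>Admissible constants exist, so the quantification over \<open>C\<close> in the
      other conjunct is not vacuous.\<close>
    show "\<exists>C>0. C \<le> C0" using C0 by blast
  next
    fix \<epsilon> C assume *: "0 < \<epsilon> \<and> \<epsilon> < \<eta> / 6" "0 < C" "C \<le> C0"
    then show "\<exists>\<Delta>>0. \<Delta> = min (C * \<epsilon>\<^sup>2) (0.5 * \<epsilon>) \<and>
        ((\<forall>k\<in>K. hausdorff_distance (P k) (P' k) < ereal \<Delta>) \<longrightarrow>
         (\<forall>k\<in>K. hausdorff_distance (voronoi_cell X K P k) (voronoi_cell X K P' k) < ereal \<epsilon>))"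
      using main by (intro exI[of _ "min (C * \<epsilon>\<^sup>2) (0.5 * \<epsilon>)"]) auto
  qed
qed

end
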